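(* Let $\gamma : I \to \mathbb{E}^3$ be a unit speed curve of osculating order $3$ with Bishop frame $\{T, M_1, M_2\}$ and Bishop curvatures $k_1, k_2$. If $\gamma$ is of type Bishop $AW(3)$, then for all $s \in I$ $$k_2(s)\left(k_1''(s) - k_1^3(s) - k_1(s) k_2^2(s)\right) = k_1(s)\left(k_2''(s) - k_2^3(s) - k_1^2(s) k_2(s)\right).$$
   Context: $I \subset \mathbb{R}$ is an interval, $\mathbb{E}^3$ is Euclidean 3-space with inner product $\langle\cdot,\cdot\rangle$ and norm $\|\cdot\|$, curves are smooth, and primes denote derivatives with respect to the arc length parameter $s$. A unit speed curve satisfies $\|\gamma'(s)\| = 1$. It is of (osculating) order $3$ if $\gamma'(s), \gamma''(s), \gamma'''(s)$ are linearly independent for all $s$. A Bishop frame (parallel transport frame) along $\gamma$ is an orthonormal frame $\{T, M_1, M_2\}$ with $T = \gamma'$ satisfying $$T' = k_1 M_1 + k_2 M_2, \qquad M_1' = -k_1 T, \qquad M_2' = -k_2 T,$$ where the functions $k_1, k_2$ are called the first and second Bishop curvatures. Write $$\overline{N}_1 = k_1 M_1 + k_2 M_2, \qquad \overline{N}_3 = \left(k_1'' - k_1^3 - k_1 k_2^2\right) M_1 + \left(k_2'' - k_2^3 - k_1^2 k_2\right) M_2.$$ The curve is of type Bishop $AW(3)$ if $\|\overline{N}_1\|^2\, \overline{N}_3 = \langle \overline{N}_3, \overline{N}_1\rangle\, \overline{N}_1$ at every $s \in I$. *)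

theory Defs
  imports "HOL-Analysis.Analysis"
begin

text \<open>
  Functions on an interval are total functions on the reals of which only the restriction to the
  interval matters: all derivatives are taken within the interval, hence one-sided at endpoints
  that belong to it. The interval must be nondegenerate, since otherwise these derivatives
  are not determined.
\<close>

definition nondegenerate_interval :: "real set \<Rightarrow> bool" where
  "nondegenerate_interval I \<longleftrightarrow> is_interval I \<and> interior I \<noteq> {}"

primrec nth_deriv :: "real set \<Rightarrow> nat \<Rightarrow> (real \<Rightarrow> 'a::real_normed_vector) \<Rightarrow> real \<Rightarrow> 'a" where
  "nth_deriv I 0 f = f"
| "nth_deriv I (Suc n) f = (\<lambda>s. vector_derivative (nth_deriv I n f) (at s within I))"

definition smooth_on :: "real set \<Rightarrow> (real \<Rightarrow> 'a::real_normed_vector) \<Rightarrow> bool" where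
  "smooth_on I f \<longleftrightarrow> (\<forall>n. \<forall>s\<in>I. nth_deriv I n f differentiable (at s within I))"

definition unit_speed_curve :: "real set \<Rightarrow> (real \<Rightarrow> real^3) \<Rightarrow> bool" where
  "unit_speed_curve I \<gamma> \<longleftrightarrow> smooth_on I \<gamma> \<and> (\<forall>s\<in>I. norm (nth_deriv I 1 \<gamma> s) = 1)"

text \<open>Injectivity is needed because \<^const>\<open>independent\<close> speaks of the set of vectors, in which
  coinciding derivatives would be identified.\<close>

definition osculating_order_3 :: "real set \<Rightarrow> (real \<Rightarrow> real^3) \<Rightarrow> bool" where
  "osculating_order_3 I \<gamma> \<longleftrightarrow>
     (\<forall>s\<in>I. inj_on (\<lambda>n. nth_deriv I n \<gamma> s) {1..3} \<and>
            independent ((\<lambda>n. nth_deriv I n \<gamma> s) ` {1..3}))"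

text \<open>Smoothness of the curvatures is no restriction: it follows from that of the curve and the
  frame, since \<open>k\<^sub>i = T' \<bullet> M\<^sub>i\<close>.\<close>

definition bishop_frame ::
  "real set \<Rightarrow> (real \<Rightarrow> real^3) \<Rightarrow> (real \<Rightarrow> real^3) \<Rightarrow> (real \<Rightarrow> real^3) \<Rightarrow> (real \<Rightarrow> real^3) \<Rightarrow>
   (real \<Rightarrow> real) \<Rightarrow> (real \<Rightarrow> real) \<Rightarrow> bool" where
  "bishop_frame I \<gamma> T M1 M2 k1 k2 \<longleftrightarrow>
     smooth_on I T \<and> smooth_on I M1 \<and> smooth_on I M2 \<and> smooth_on I k1 \<and> smooth_on I k2 \<and>
     (\<forall>s\<in>I.
        T s = nth_deriv I 1 \<gamma> s \<and>
        norm (T s) = 1 \<and> norm (M1 s) = 1 \<and> norm (M2 s) = 1 \<and>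
        T s \<bullet> M1 s = 0 \<and> T s \<bullet> M2 s = 0 \<and> M1 s \<bullet> M2 s = 0 \<and>
        (T has_vector_derivative (k1 s *\<^sub>R M1 s + k2 s *\<^sub>R M2 s)) (at s within I) \<and>
        (M1 has_vector_derivative (- k1 s *\<^sub>R T s)) (at s within I) \<and>
        (M2 has_vector_derivative (- k2 s *\<^sub>R T s)) (at s within I))"

definition N1_bar ::
  "(real \<Rightarrow> real^3) \<Rightarrow> (real \<Rightarrow> real^3) \<Rightarrow> (real \<Rightarrow> real) \<Rightarrow> (real \<Rightarrow> real) \<Rightarrow> real \<Rightarrow> real^3" where
  "N1_bar M1 M2 k1 k2 s = k1 s *\<^sub>R M1 s + k2 s *\<^sub>R M2 s"

definition N3_bar ::
  "real set \<Rightarrow> (real \<Rightarrow> real^3) \<Rightarrow> (real \<Rightarrow> real^3) \<Rightarrow> (real \<Rightarrow> real) \<Rightarrow> (real \<Rightarrow> real) \<Rightarrow>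
   real \<Rightarrow> real^3" where
  "N3_bar I M1 M2 k1 k2 s =
     (nth_deriv I 2 k1 s - k1 s ^ 3 - k1 s * k2 s ^ 2) *\<^sub>R M1 s +
     (nth_deriv I 2 k2 s - k2 s ^ 3 - k1 s ^ 2 * k2 s) *\<^sub>R M2 s"

definition bishop_AW3 ::
  "real set \<Rightarrow> (real \<Rightarrow> real^3) \<Rightarrow> (real \<Rightarrow> real^3) \<Rightarrow> (real \<Rightarrow> real) \<Rightarrow> (real \<Rightarrow> real) \<Rightarrow> bool" where
  "bishop_AW3 I M1 M2 k1 k2 \<longleftrightarrow>
     (\<forall>s\<in>I. (norm (N1_bar M1 M2 k1 k2 s))^2 *\<^sub>R N3_bar I M1 M2 k1 k2 s =
            (N3_bar I M1 M2 k1 k2 s \<bullet> N1_bar M1 M2 k1 k2 s) *\<^sub>R N1_bar M1 M2 k1 k2 s)"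

end

theory Submission
  imports Defs
begin

text \<open>
  At each point the statement is linear algebra in the normal plane spanned by \<open>M1\<close> and \<open>M2\<close>.
  The Bishop AW(3) condition is the identity \<open>N3_bar = proj N3_bar\<close>, multiplied by
  \<open>(norm N1_bar)\<^sup>2\<close>, where \<open>proj\<close> is the orthogonal projection to the line of \<open>N1_bar\<close>. So
  the two vectors are linearly dependent, which includes the case \<open>N1_bar = 0\<close>.
  The asserted identity is the vanishing of the determinant of their coordinates in the
  orthonormal basis \<open>M1\<close>, \<open>M2\<close>.
\<close>

text \<open>
  Pair the hypothesis with the vector \<open>r\<close> obtained from \<open>v\<close> by a quarter turn in the plane. The
  right-hand side is a multiple of \<open>v\<close> and hence orthogonal to \<open>r\<close>, while \<open>w \<bullet> r\<close> is the
  coordinate determinant \<open>a * B - b * A\<close>. So that determinant is zero unless \<open>v = 0\<close>, and in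
  that case \<open>a\<close> and \<open>b\<close> are zero.
\<close>

lemma coordinate_determinant_zero_if_eq_projection:
  fixes e f v w :: "'a::real_inner" and a b A B :: real
  assumes norms: "norm e = 1" "norm f = 1" and orth: "e \<bullet> f = 0"
    and v: "v = a *\<^sub>R e + b *\<^sub>R f" and w: "w = A *\<^sub>R e + B *\<^sub>R f"
    and proj: "(norm v)\<^sup>2 *\<^sub>R w = (w \<bullet> v) *\<^sub>R v"
  shows "b * A = a * B"
proof (cases "v = 0")
  case True
  have "v \<bullet> e = a" "v \<bullet> f = b"
    using norms orth by (simp_all add: v inner_add_left inner_commute[of f e] norm_eq_1)
  with True show ?thesis by simp
next
  case False
  define r where "r = a *\<^sub>R f - b *\<^sub>R e"
  have gram: "e \<bullet> e = 1" "f \<bullet> f = 1" "f \<bullet> e = 0"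
    using norms orth by (simp_all add: norm_eq_1 inner_commute)
  have "v \<bullet> r = 0" and det: "w \<bullet> r = a * B - b * A"
    using orth gram by (simp_all add: v w r_def inner_simps algebra_simps)
  then have "(norm v)\<^sup>2 * (w \<bullet> r) = 0"
    using arg_cong[OF proj, of "\<lambda>x. x \<bullet> r"] by simp
  with False det show ?thesis by simp
qed

theorem proposition4p10:
  fixes I :: "real set" and \<gamma> T M1 M2 :: "real \<Rightarrow> real^3" and k1 k2 :: "real \<Rightarrow> real"
  assumes "nondegenerate_interval I"
    and "unit_speed_curve I \<gamma>"
    and "osculating_order_3 I \<gamma>"
    and "bishop_frame I \<gamma> T M1 M2 k1 k2"
    and "bishop_AW3 I M1 M2 k1 k2"
  shows "\<forall>s\<in>I. k2 s * (nth_deriv I 2 k1 s - k1 s ^ 3 - k1 s * k2 s ^ 2) =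
               k1 s * (nth_deriv I 2 k2 s - k2 s ^ 3 - k1 s ^ 2 * k2 s)"
proof
  fix s assume s: "s \<in> I"
  have frame: "norm (M1 s) = 1" "norm (M2 s) = 1" "M1 s \<bullet> M2 s = 0"
    using assms(4) s unfolding bishop_frame_def by blast+
  have "(norm (N1_bar M1 M2 k1 k2 s))\<^sup>2 *\<^sub>R N3_bar I M1 M2 k1 k2 s =
      (N3_bar I M1 M2 k1 k2 s \<bullet> N1_bar M1 M2 k1 k2 s) *\<^sub>R N1_bar M1 M2 k1 k2 s"
    using assms(5) s unfolding bishop_AW3_def by blast
  from coordinate_determinant_zero_if_eq_projection[OF frame N1_bar_def N3_bar_def this]
  show "k2 s * (nth_deriv I 2 k1 s - k1 s ^ 3 - k1 s * k2 s ^ 2) =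
        k1 s * (nth_deriv I 2 k2 s - k2 s ^ 3 - k1 s ^ 2 * k2 s)" .
qed

end
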